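(* Let $\Gamma$ be a discrete subgroup of $SL(2,\mathbb{R})$, let $m,\delta\ge0$ and $\lambda$ be integers, and let $\alpha\in\widetilde\Gamma$. Then $\Pi^\delta_m(T^J_\lambda(\alpha)\Phi)=T^P_{\lambda+2m+2\delta}(\alpha)(\Pi^\delta_m\Phi)$ for all $\Phi\in\mathcal{J}_\lambda(\Gamma)_\delta$.
   Context: $\mathcal{F}$ is the ring of holomorphic functions on the upper half plane $\mathcal{H}$; $\mathcal{F}[[X]]_\delta=X^\delta\mathcal{F}[[X]]$; $\mathcal{F}_m[X]$ polynomials of degree $\le m$ over $\mathcal{F}$. For $\alpha=\begin{pmatrix} a&b\\ c&d\end{pmatrix}\in GL^+(2,\mathbb{R})$: $\alpha z=(az+b)/(cz+d)$, $\mathfrak{J}(\alpha,z)=cz+d$, $\mathfrak{K}(\alpha,z)=c/(cz+d)$; $(\Phi\mid^J_\lambda\alpha)(z,X)=\det(\alpha)^{\lambda/2}\mathfrak{J}(\alpha,z)^{-\lambda}e^{-\mathfrak{K}(\alpha,z)X}\Phi(\alpha z,\det(\alpha)\mathfrak{J}(\alpha,z)^{-2}X)$; $(F\,\|_w\,\alpha)(z,X)=\det(\alpha)^{w/2}\mathfrak{J}(\alpha,z)^{-w}F(\alpha z,\det(\alpha)^{-1}\mathfrak{J}(\alpha,z)^2(X-\mathfrak{K}(\alpha,z)))$. $\mathcal{J}_\lambda(\Gamma)_\delta=\{\Phi\in\mathcal{F}[[X]]_\delta:\Phi\mid^J_\lambda\gamma=\Phi\ \forall\gamma\in\Gamma\}$;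 $QP^m_w(\Gamma)=\{F\in\mathcal{F}_m[X]:F\,\|_w\,\gamma=F\ \forall\gamma\in\Gamma\}$. For $\Phi=\sum_{k\ge0}\phi_kX^{k+\delta}$, $\Pi^\delta_m\Phi=\sum_{r=0}^m\frac1{r!}\phi_{m-r}X^r$. The commensurator $\widetilde\Gamma$ is the set of $g\in GL^+(2,\mathbb{R})$ with $g\Gamma g^{-1}\cap\Gamma$ of finite index in both; for $\alpha\in\widetilde\Gamma$ write $\Gamma\alpha\Gamma=\coprod_{i=1}^s\Gamma\alpha_i$, and set $T^J_\lambda(\alpha)\Phi=\sum_i\Phi\mid^J_\lambda\alpha_i$, $T^P_w(\alpha)F=\sum_iF\,\|_w\,\alpha_i$. *)

theory Defs
  imports
    "HOL-Analysis.Analysis"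
    "HOL-Computational_Algebra.Computational_Algebra"
    "HOL-Algebra.Coset"
begin

no_notation fps_nth (infixl \<open>$\<close> 75)

section \<open>The ring of holomorphic functions on the upper half plane\<close>

definition uhp :: "complex set" where
  "uhp = {z. Im z > 0}"

lemma open_uhp: "open uhp"
  unfolding uhp_def by (rule open_halfspace_Im_gt)

text \<open>Functions in HOL are total; requiring the value 0 off the upper half plane makes equality
  in this type coincide with equality of functions on the upper half plane.\<close>

typedef holo_uhp = "{f :: complex \<Rightarrow> complex. f holomorphic_on uhp \<and> (\<forall>z. z \<notin> uhp \<longrightarrow> f z = 0)}"
  morphisms eval_holo Abs_holo
  by (rule exI[of _ "\<lambda>_. 0"]) auto

setup_lifting type_definition_holo_uhp

instantiation holo_uhp :: comm_ring_1
begin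

lift_definition zero_holo_uhp :: holo_uhp is "\<lambda>_. 0" by auto
lift_definition one_holo_uhp :: holo_uhp is "\<lambda>z. if z \<in> uhp then 1 else 0"
  by (auto intro: holomorphic_transform[of "\<lambda>_. 1"])
lift_definition plus_holo_uhp :: "holo_uhp \<Rightarrow> holo_uhp \<Rightarrow> holo_uhp" is "\<lambda>f g z. f z + g z"
  by (auto intro!: holomorphic_intros)
lift_definition minus_holo_uhp :: "holo_uhp \<Rightarrow> holo_uhp \<Rightarrow> holo_uhp" is "\<lambda>f g z. f z - g z"
  by (auto intro!: holomorphic_intros)
lift_definition uminus_holo_uhp :: "holo_uhp \<Rightarrow> holo_uhp" is "\<lambda>f z. - f z"
  by (auto intro!: holomorphic_intros)
lift_definition times_holo_uhp :: "holo_uhp \<Rightarrow> holo_uhp \<Rightarrow> holo_uhp" is "\<lambda>f g z. f z * g z"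
  by (auto intro!: holomorphic_intros)

instance
proof
  show "(0 :: holo_uhp) \<noteq> 1"
  proof (transfer, rule notI)
    assume "(\<lambda>_. 0 :: complex) = (\<lambda>z. if z \<in> uhp then 1 else 0)"
    from fun_cong[OF this, of \<i>] show False by (simp add: uhp_def)
  qed
qed (transfer; auto simp: algebra_simps)+

end

lemma eval_holo_simps [simp]:
  "eval_holo 0 z = 0"
  "z \<in> uhp \<Longrightarrow> eval_holo 1 z = 1"
  "eval_holo (f + g) z = eval_holo f z + eval_holo g z"
  "eval_holo (f - g) z = eval_holo f z - eval_holo g z"
  "eval_holo (- f) z = - eval_holo f z"
  "eval_holo (f * g) z = eval_holo f z * eval_holo g z"
  by (transfer; simp)+

lemma eval_holo_sum: "eval_holo (sum f A) z = (\<Sum>x\<in>A. eval_holo (f x) z)"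
  by (induction A rule: infinite_finite_induct) auto

lemma holomorphic_eval_holo: "eval_holo f holomorphic_on uhp"
  using eval_holo[of f] by simp

lemma holo_uhp_eqI:
  assumes "\<And>z. z \<in> uhp \<Longrightarrow> eval_holo f z = eval_holo g z"
  shows "f = g"
proof -
  have "eval_holo f z = eval_holo g z" for z
    using assms[of z] eval_holo[of f] eval_holo[of g] by (cases "z \<in> uhp") simp_all
  then have "eval_holo f = eval_holo g" by (rule ext)
  then show ?thesis by (simp add: eval_holo_inject)
qed

text \<open>Meaningful only for \<open>f\<close> holomorphic on the upper half plane.\<close>

definition holo_of :: "(complex \<Rightarrow> complex) \<Rightarrow> holo_uhp" where
  "holo_of f = Abs_holo (\<lambda>z. if z \<in> uhp then f z else 0)"

lemma eval_holo_of:
  assumes "f holomorphic_on uhp" "z \<in> uhp"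
  shows "eval_holo (holo_of f) z = f z"
proof -
  have "(\<lambda>z. if z \<in> uhp then f z else 0) holomorphic_on uhp"
    using assms(1) by (rule holomorphic_transform) auto
  then show ?thesis
    unfolding holo_of_def using assms(2) by (subst Abs_holo_inverse) auto
qed

section \<open>Power series and polynomials over this ring\<close>

text \<open>The ring of formal power series over it is \<^typ>\<open>holo_uhp fps\<close>. For such a series (or a
  polynomial in \<^typ>\<open>holo_uhp poly\<close>) and a point \<open>z\<close>, \<open>\<Phi>(z, X)\<close> is the complex series
  (polynomial) obtained by evaluating the coefficients at \<open>z\<close>.\<close>

definition fps_at :: "holo_uhp fps \<Rightarrow> complex \<Rightarrow> complex fps" where
  "fps_at \<Phi> z = Abs_fps (\<lambda>n. eval_holo (fps_nth \<Phi> n) z)"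

definition poly_at :: "holo_uhp poly \<Rightarrow> complex \<Rightarrow> complex poly" where
  "poly_at F z = map_poly (\<lambda>f. eval_holo f z) F"

definition fps_delta :: "nat \<Rightarrow> holo_uhp fps set" where
  "fps_delta \<delta> = {fps_X ^ \<delta> * \<Psi> | \<Psi>. True}"

definition poly_upto :: "nat \<Rightarrow> holo_uhp poly set" where
  "poly_upto m = {F. degree F \<le> m}"

lemma fps_nth_fps_at [simp]: "fps_nth (fps_at \<Phi> z) n = eval_holo (fps_nth \<Phi> n) z"
  by (simp add: fps_at_def)

lemma coeff_poly_at [simp]: "coeff (poly_at F z) n = eval_holo (coeff F n) z"
  by (simp add: poly_at_def coeff_map_poly)

lemma holo_fps_eqI:
  assumes "\<And>z. z \<in> uhp \<Longrightarrow> fps_at \<Phi> z = fps_at \<Psi> z"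
  shows "\<Phi> = \<Psi>"
proof (rule fps_ext, rule holo_uhp_eqI)
  fix n z assume "z \<in> uhp"
  from arg_cong[OF assms[OF this], of "\<lambda>f. fps_nth f n"]
  show "eval_holo (fps_nth \<Phi> n) z = eval_holo (fps_nth \<Psi> n) z" by simp
qed

lemma holo_poly_eqI:
  assumes "\<And>z. z \<in> uhp \<Longrightarrow> poly_at F z = poly_at G z"
  shows "F = G"
proof (rule poly_eqI, rule holo_uhp_eqI)
  fix n z assume "z \<in> uhp"
  from arg_cong[OF assms[OF this], of "\<lambda>f. coeff f n"]
  show "eval_holo (coeff F n) z = eval_holo (coeff G n) z" by simp
qed

section \<open>Matrix groups, commensurators and coset decompositions\<close>

definition GL2_pos :: "(real^2^2) monoid" where
  "GL2_pos = \<lparr>carrier = {A. det A > 0}, mult = (**), one = mat 1\<rparr>"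

definition SL2_real :: "(real^2^2) monoid" where
  "SL2_real = GL2_pos\<lparr>carrier := {A. det A = 1}\<rparr>"

lemma GL2_pos_simps [simp]:
  "carrier GL2_pos = {A. det A > 0}" "mult GL2_pos = (**)" "one GL2_pos = mat 1"
  by (simp_all add: GL2_pos_def)

lemma GL2_left_inverse:
  fixes A :: "real^2^2"
  assumes "det A > 0"
  obtains B where "B ** A = mat 1" "det B > 0"
proof -
  have "invertible A" using assms by (simp add: invertible_det_nz)
  then obtain B where *: "B ** A = mat 1"
    unfolding invertible_def by blast
  have "det B * det A = 1"
    using arg_cong[OF *, of det] by (simp add: det_mul)
  with assms have "det B > 0"
    using zero_less_mult_pos2[of "det B" "det A"] by simp
  with * show thesis by (rule that)
qed

lemma group_GL2_pos: "group GL2_pos"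
proof (rule groupI)
  fix x assume "x \<in> carrier GL2_pos"
  then have "det x > 0" by simp
  then obtain B where "B ** x = mat 1" "det B > 0" by (rule GL2_left_inverse)
  then show "\<exists>y\<in>carrier GL2_pos. y \<otimes>\<^bsub>GL2_pos\<^esub> x = \<one>\<^bsub>GL2_pos\<^esub>"
    by (intro bexI[of _ B]) simp_all
qed (simp_all add: det_mul matrix_mul_assoc)

definition finite_index :: "(real^2^2) set \<Rightarrow> (real^2^2) set \<Rightarrow> bool" where
  "finite_index H K \<longleftrightarrow> finite (rcosets\<^bsub>GL2_pos\<lparr>carrier := K\<rparr>\<^esub> H)"

definition conjugate :: "real^2^2 \<Rightarrow> (real^2^2) set \<Rightarrow> (real^2^2) set" where
  "conjugate g \<Gamma> = (\<lambda>\<gamma>. g \<otimes>\<^bsub>GL2_pos\<^esub> \<gamma> \<otimes>\<^bsub>GL2_pos\<^esub> inv\<^bsub>GL2_pos\<^esub> g) ` \<Gamma>"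

definition commensurator :: "(real^2^2) set \<Rightarrow> (real^2^2) set" where
  "commensurator \<Gamma> = {g \<in> carrier GL2_pos.
     finite_index (conjugate g \<Gamma> \<inter> \<Gamma>) \<Gamma> \<and> finite_index (conjugate g \<Gamma> \<inter> \<Gamma>) (conjugate g \<Gamma>)}"

definition double_coset :: "(real^2^2) set \<Rightarrow> real^2^2 \<Rightarrow> (real^2^2) set" where
  "double_coset \<Gamma> \<alpha> = (\<Gamma> #>\<^bsub>GL2_pos\<^esub> \<alpha>) <#>\<^bsub>GL2_pos\<^esub> \<Gamma>"

definition coset_decomposition :: "(real^2^2) set \<Rightarrow> real^2^2 \<Rightarrow> (real^2^2) list \<Rightarrow> bool" where
  "coset_decomposition \<Gamma> \<alpha> as \<longleftrightarrow>
     double_coset \<Gamma> \<alpha> = (\<Union>i<length as. \<Gamma> #>\<^bsub>GL2_pos\<^esub> (as ! i)) \<and>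
     disjoint_family_on (\<lambda>i. \<Gamma> #>\<^bsub>GL2_pos\<^esub> (as ! i)) {..<length as}"

text \<open>The sum of \<open>f \<alpha>\<^sub>i\<close> over the representatives \<open>\<alpha>\<^sub>1, \<dots>, \<alpha>\<^sub>s\<close> of a chosen decomposition of
  \<open>\<Gamma>\<alpha>\<Gamma>\<close>. Decompositions exist for \<open>\<alpha>\<close> in the commensurator, and on automorphic objects the sum
  does not depend on the choice: see \<open>coset_decomposition_exists\<close> and \<open>coset_sum_eq\<close>
  (specialised to the Hecke operators in \<open>heckeJ_eq\<close> and \<open>heckeP_eq\<close>) below.\<close>

definition coset_sum :: "(real^2^2) set \<Rightarrow> real^2^2 \<Rightarrow> (real^2^2 \<Rightarrow> 'a::comm_monoid_add) \<Rightarrow> 'a" where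
  "coset_sum \<Gamma> \<alpha> f =
     (let as = (SOME as. coset_decomposition \<Gamma> \<alpha> as) in \<Sum>i<length as. f (as ! i))"

section \<open>The two slash operators\<close>

definition autJ :: "real^2^2 \<Rightarrow> complex \<Rightarrow> complex" where
  "autJ \<alpha> z = of_real (\<alpha>$2$1) * z + of_real (\<alpha>$2$2)"

definition moebius_act :: "real^2^2 \<Rightarrow> complex \<Rightarrow> complex" where
  "moebius_act \<alpha> z = (of_real (\<alpha>$1$1) * z + of_real (\<alpha>$1$2)) / autJ \<alpha> z"

definition autK :: "real^2^2 \<Rightarrow> complex \<Rightarrow> complex" where
  "autK \<alpha> z = of_real (\<alpha>$2$1) / autJ \<alpha> z"

definition slash_factor :: "int \<Rightarrow> real^2^2 \<Rightarrow> complex \<Rightarrow> complex" where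
  "slash_factor w \<alpha> z = of_real (det \<alpha> powr (of_int w / 2)) * autJ \<alpha> z powi (- w)"

text \<open>\<open>(\<Phi> | \<alpha>)(z, X)\<close> and \<open>(F || \<alpha>)(z, X)\<close> for a fixed point \<open>z\<close>; the operators themselves
  then collect the coefficients as functions of \<open>z\<close> (see \<open>fps_at_slashJ\<close> and
  \<open>poly_at_slashP\<close>).\<close>

definition slashJ_at :: "int \<Rightarrow> real^2^2 \<Rightarrow> holo_uhp fps \<Rightarrow> complex \<Rightarrow> complex fps" where
  "slashJ_at lam \<alpha> \<Phi> z =
     fps_const (slash_factor lam \<alpha> z) * fps_exp (- autK \<alpha> z) *
     fps_compose (fps_at \<Phi> (moebius_act \<alpha> z)) (fps_const (of_real (det \<alpha>) * autJ \<alpha> z powi (-2)) * fps_X)"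

definition slashP_at :: "int \<Rightarrow> real^2^2 \<Rightarrow> holo_uhp poly \<Rightarrow> complex \<Rightarrow> complex poly" where
  "slashP_at w \<alpha> F z =
     smult (slash_factor w \<alpha> z)
       (pcompose (poly_at F (moebius_act \<alpha> z))
          (smult (inverse (of_real (det \<alpha>)) * autJ \<alpha> z ^ 2) [:- autK \<alpha> z, 1:]))"

definition slashJ :: "int \<Rightarrow> real^2^2 \<Rightarrow> holo_uhp fps \<Rightarrow> holo_uhp fps" where
  "slashJ lam \<alpha> \<Phi> = Abs_fps (\<lambda>n. holo_of (\<lambda>z. fps_nth (slashJ_at lam \<alpha> \<Phi> z) n))"

definition slashP :: "int \<Rightarrow> real^2^2 \<Rightarrow> holo_uhp poly \<Rightarrow> holo_uhp poly" where
  "slashP w \<alpha> F = Abs_poly (\<lambda>n. holo_of (\<lambda>z. coeff (slashP_at w \<alpha> F z) n))"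

section \<open>Jacobi-like forms, quasimodular polynomials, and Hecke operators\<close>

definition jacobi_like :: "(real^2^2) set \<Rightarrow> int \<Rightarrow> nat \<Rightarrow> holo_uhp fps set" where
  "jacobi_like \<Gamma> lam \<delta> = {\<Phi> \<in> fps_delta \<delta>. \<forall>\<gamma>\<in>\<Gamma>. slashJ lam \<gamma> \<Phi> = \<Phi>}"

definition quasimodular_poly :: "(real^2^2) set \<Rightarrow> int \<Rightarrow> nat \<Rightarrow> holo_uhp poly set" where
  "quasimodular_poly \<Gamma> w m = {F \<in> poly_upto m. \<forall>\<gamma>\<in>\<Gamma>. slashP w \<gamma> F = F}"

text \<open>For \<open>\<Phi> = (\<Sum>k. \<phi>\<^sub>k X\<^bsup>k+\<delta>\<^esup>)\<close> the coefficient \<open>\<phi>\<^sub>k\<close> is \<^term>\<open>fps_nth \<Phi> (k + \<delta>)\<close>.\<close>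

definition Pi_map :: "nat \<Rightarrow> nat \<Rightarrow> holo_uhp fps \<Rightarrow> holo_uhp poly" where
  "Pi_map \<delta> m \<Phi> = (\<Sum>r\<le>m. monom (holo_of (\<lambda>_. 1 / fact r) * fps_nth \<Phi> (m - r + \<delta>)) r)"

definition heckeJ :: "(real^2^2) set \<Rightarrow> int \<Rightarrow> real^2^2 \<Rightarrow> holo_uhp fps \<Rightarrow> holo_uhp fps" where
  "heckeJ \<Gamma> lam \<alpha> \<Phi> = coset_sum \<Gamma> \<alpha> (\<lambda>\<beta>. slashJ lam \<beta> \<Phi>)"

definition heckeP :: "(real^2^2) set \<Rightarrow> int \<Rightarrow> real^2^2 \<Rightarrow> holo_uhp poly \<Rightarrow> holo_uhp poly" where
  "heckeP \<Gamma> w \<alpha> F = coset_sum \<Gamma> \<alpha> (\<lambda>\<beta>. slashP w \<beta> F)"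

section \<open>Well-definedness of the operators\<close>

lemma subgroup_SL2_imp_GL2:
  assumes "subgroup \<Gamma> SL2_real"
  shows "subgroup \<Gamma> GL2_pos" "\<gamma> \<in> \<Gamma> \<Longrightarrow> det \<gamma> = 1"
proof -
  interpret GL: group GL2_pos by (rule group_GL2_pos)
  interpret S: subgroup \<Gamma> SL2_real by fact
  have det1: "det \<gamma> = 1" if "\<gamma> \<in> \<Gamma>" for \<gamma>
    using S.mem_carrier[OF that] by (simp add: SL2_real_def)
  then show "\<gamma> \<in> \<Gamma> \<Longrightarrow> det \<gamma> = 1" .
  show "subgroup \<Gamma> GL2_pos"
  proof (rule GL.subgroupI)
    show "\<Gamma> \<subseteq> carrier GL2_pos" using det1 by auto
    show "\<Gamma> \<noteq> {}" using S.one_closed by blast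
  next
    fix a b assume "a \<in> \<Gamma>" "b \<in> \<Gamma>"
    then show "a \<otimes>\<^bsub>GL2_pos\<^esub> b \<in> \<Gamma>" using S.m_closed[of a b] by (simp add: SL2_real_def)
  next
    fix a assume a: "a \<in> \<Gamma>"
    have "group SL2_real"
    proof (rule groupI)
      fix x assume "x \<in> carrier SL2_real"
      then have x: "det x = 1" by (simp add: SL2_real_def)
      then have "det x > 0" by simp
      then obtain B where B: "B ** x = mat 1" by (rule GL2_left_inverse)
      from arg_cong[OF B, of det] x have "det B = 1" by (simp add: det_mul)
      with B show "\<exists>y\<in>carrier SL2_real. y \<otimes>\<^bsub>SL2_real\<^esub> x = \<one>\<^bsub>SL2_real\<^esub>"
        by (auto simp: SL2_real_def)
    qed (auto simp: SL2_real_def det_mul matrix_mul_assoc)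
    then interpret SL: group SL2_real .
    have "inv\<^bsub>SL2_real\<^esub> a ** a = mat 1"
      using SL.l_inv[OF S.mem_carrier[OF a]] by (simp add: SL2_real_def)
    moreover have "inv\<^bsub>SL2_real\<^esub> a \<in> \<Gamma>" using a by simp
    ultimately have "inv\<^bsub>GL2_pos\<^esub> a = inv\<^bsub>SL2_real\<^esub> a"
      using det1[OF a] det1[of "inv\<^bsub>SL2_real\<^esub> a"] by (intro GL.inv_equality) auto
    then show "inv\<^bsub>GL2_pos\<^esub> a \<in> \<Gamma>" using a by simp
  qed
qed

lemma double_coset_alt:
  "double_coset \<Gamma> \<alpha> = {\<gamma> ** \<alpha> ** \<gamma>' | \<gamma> \<gamma>'. \<gamma> \<in> \<Gamma> \<and> \<gamma>' \<in> \<Gamma>}"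
  unfolding double_coset_def set_mult_def r_coset_def by auto

theorem coset_decomposition_exists:
  assumes "subgroup \<Gamma> GL2_pos" "\<alpha> \<in> commensurator \<Gamma>"
  shows "\<exists>as. coset_decomposition \<Gamma> \<alpha> as"
proof -
  interpret GL: group GL2_pos by (rule group_GL2_pos)
  interpret S: subgroup \<Gamma> GL2_pos by fact
  have \<alpha>: "\<alpha> \<in> carrier GL2_pos" using assms(2) by (simp add: commensurator_def)
  define H where "H = conjugate \<alpha> \<Gamma> \<inter> \<Gamma>"
  define R where "R = (\<lambda>\<gamma>. \<Gamma> #>\<^bsub>GL2_pos\<^esub> (\<alpha> ** \<gamma>)) ` \<Gamma>"
  have one: "mat 1 \<in> \<Gamma>" using S.one_closed by simp
  have "conjugate \<alpha> \<Gamma> \<subseteq> carrier GL2_pos"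
    using \<alpha> S.subset by (auto simp: conjugate_def simp del: GL2_pos_simps intro!: GL.m_closed GL.inv_closed)
  have "R \<subseteq> (\<lambda>C. (\<Gamma> <#>\<^bsub>GL2_pos\<^esub> C) #>\<^bsub>GL2_pos\<^esub> \<alpha>) ` (rcosets\<^bsub>GL2_pos\<lparr>carrier := conjugate \<alpha> \<Gamma>\<rparr>\<^esub> H)"
  proof
    fix C assume "C \<in> R"
    then obtain \<gamma> where \<gamma>: "\<gamma> \<in> \<Gamma>" "C = \<Gamma> #>\<^bsub>GL2_pos\<^esub> (\<alpha> ** \<gamma>)" by (auto simp: R_def)
    define x where "x = \<alpha> ** \<gamma> ** inv\<^bsub>GL2_pos\<^esub> \<alpha>"
    have x: "x \<in> conjugate \<alpha> \<Gamma>" using \<gamma> by (auto simp: x_def conjugate_def)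
    have inv: "inv\<^bsub>GL2_pos\<^esub> \<alpha> ** \<alpha> = mat 1" using GL.l_inv[OF \<alpha>] by simp
    have x\<alpha>: "x ** \<alpha> = \<alpha> ** \<gamma>"
      unfolding x_def matrix_mul_assoc[symmetric] inv by simp
    have 1: "mat 1 \<in> H"
    proof -
      have "\<alpha> ** mat 1 ** inv\<^bsub>GL2_pos\<^esub> \<alpha> = mat 1" using GL.r_inv[OF \<alpha>] by simp
      with one show ?thesis unfolding H_def conjugate_def by (auto simp: image_iff intro!: bexI[of _ "mat 1"])
    qed
    have "\<Gamma> <#>\<^bsub>GL2_pos\<^esub> (H #>\<^bsub>GL2_pos\<^esub> x) #>\<^bsub>GL2_pos\<^esub> \<alpha> = \<Gamma> #>\<^bsub>GL2_pos\<^esub> (x ** \<alpha>)"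
    proof safe
      fix y assume "y \<in> \<Gamma> <#>\<^bsub>GL2_pos\<^esub> (H #>\<^bsub>GL2_pos\<^esub> x) #>\<^bsub>GL2_pos\<^esub> \<alpha>"
      then obtain g h where "g \<in> \<Gamma>" "h \<in> H" "y = (g ** (h ** x)) ** \<alpha>"
        by (auto simp: set_mult_def r_coset_def)
      moreover have "g ** h \<in> \<Gamma>" using S.m_closed[of g h] calculation by (auto simp: H_def)
      ultimately show "y \<in> \<Gamma> #>\<^bsub>GL2_pos\<^esub> (x ** \<alpha>)"
        by (auto simp: r_coset_def matrix_mul_assoc intro!: bexI[of _ "g ** h"])
    next
      fix y assume "y \<in> \<Gamma> #>\<^bsub>GL2_pos\<^esub> (x ** \<alpha>)"
      then obtain g where g: "g \<in> \<Gamma>" "y = g ** x ** \<alpha>"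
        by (auto simp: r_coset_def matrix_mul_assoc)
      have "x \<in> H #>\<^bsub>GL2_pos\<^esub> x" using 1 by (auto simp: r_coset_def intro!: bexI[of _ "mat 1"])
      with g have "g ** x \<in> \<Gamma> <#>\<^bsub>GL2_pos\<^esub> (H #>\<^bsub>GL2_pos\<^esub> x)" by (auto simp: set_mult_def)
      with g show "y \<in> \<Gamma> <#>\<^bsub>GL2_pos\<^esub> (H #>\<^bsub>GL2_pos\<^esub> x) #>\<^bsub>GL2_pos\<^esub> \<alpha>"
        by (auto simp: r_coset_def[of _ "\<Gamma> <#>\<^bsub>GL2_pos\<^esub> (H #>\<^bsub>GL2_pos\<^esub> x)"])
    qed
    with x show "C \<in> (\<lambda>C. (\<Gamma> <#>\<^bsub>GL2_pos\<^esub> C) #>\<^bsub>GL2_pos\<^esub> \<alpha>) `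
        (rcosets\<^bsub>GL2_pos\<lparr>carrier := conjugate \<alpha> \<Gamma>\<rparr>\<^esub> H)"
      unfolding \<gamma>(2) x\<alpha>
      by (intro image_eqI[of _ _ "H #>\<^bsub>GL2_pos\<^esub> x"]) (auto simp: RCOSETS_def r_coset_def)
  qed
  moreover have "finite (rcosets\<^bsub>GL2_pos\<lparr>carrier := conjugate \<alpha> \<Gamma>\<rparr>\<^esub> H)"
    using assms(2) by (simp add: commensurator_def finite_index_def H_def)
  ultimately have "finite R" by (meson finite_surj)
  then obtain Cs where Cs: "set Cs = R" "distinct Cs" using finite_distinct_list by blast
  define rep where "rep C = (SOME x. x \<in> C)" for C :: "(real^2^2) set"
  have rep: "\<Gamma> #>\<^bsub>GL2_pos\<^esub> (rep C) = C" if "C \<in> R" for C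
  proof -
    from that obtain \<gamma> where \<gamma>: "\<gamma> \<in> \<Gamma>" "C = \<Gamma> #>\<^bsub>GL2_pos\<^esub> (\<alpha> ** \<gamma>)" by (auto simp: R_def)
    have c: "\<alpha> ** \<gamma> \<in> carrier GL2_pos"
      using GL.m_closed[OF \<alpha> S.mem_carrier[OF \<gamma>(1)]] by simp
    have "\<alpha> ** \<gamma> \<in> C" using GL.rcos_self[OF c assms(1)] \<gamma> by simp
    then have "rep C \<in> C" unfolding rep_def by (rule someI)
    then show ?thesis using GL.repr_independence[OF _ c assms(1)] \<gamma>(2) by simp
  qed
  have disj: "C \<inter> D = {}" if "C \<in> R" "D \<in> R" "C \<noteq> D" for C D
  proof -
    have "E \<in> rcosets\<^bsub>GL2_pos\<^esub> \<Gamma>" if E: "E \<in> R" for E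
    proof -
      from E obtain \<gamma> where \<gamma>: "\<gamma> \<in> \<Gamma>" "E = \<Gamma> #>\<^bsub>GL2_pos\<^esub> (\<alpha> ** \<gamma>)" by (auto simp: R_def)
      have "\<alpha> ** \<gamma> \<in> carrier GL2_pos"
        using GL.m_closed[OF \<alpha> S.mem_carrier[OF \<gamma>(1)]] by simp
      then show ?thesis unfolding \<gamma>(2) by (rule GL.rcosetsI[OF S.subset])
    qed
    from this[OF that(1)] this[OF that(2)] show ?thesis
      using GL.rcos_disjoint[OF assms(1)] that(3) by (auto simp: pairwise_def disjnt_def)
  qed
  have union: "double_coset \<Gamma> \<alpha> = \<Union>R"
    by (auto simp: double_coset_alt R_def r_coset_def matrix_mul_assoc)
  have nth: "\<Gamma> #>\<^bsub>GL2_pos\<^esub> (map rep Cs ! i) = Cs ! i" if "i < length Cs" for i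
    using rep[of "Cs ! i"] that Cs(1) by auto
  have "coset_decomposition \<Gamma> \<alpha> (map rep Cs)"
    unfolding coset_decomposition_def
  proof
    have "(\<Union>i<length (map rep Cs). \<Gamma> #>\<^bsub>GL2_pos\<^esub> (map rep Cs ! i)) = (\<Union>i<length Cs. Cs ! i)"
      using nth by auto
    also have "\<dots> = \<Union>R" unfolding Cs(1)[symmetric] by (auto simp: set_conv_nth)
    finally show "double_coset \<Gamma> \<alpha> = (\<Union>i<length (map rep Cs). \<Gamma> #>\<^bsub>GL2_pos\<^esub> (map rep Cs ! i))"
      using union by simp
    show "disjoint_family_on (\<lambda>i. \<Gamma> #>\<^bsub>GL2_pos\<^esub> (map rep Cs ! i)) {..<length (map rep Cs)}"
      unfolding disjoint_family_on_def
    proof (intro ballI impI)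
      fix i j assume "i \<in> {..<length (map rep Cs)}" "j \<in> {..<length (map rep Cs)}" "i \<noteq> j"
      then show "(\<Gamma> #>\<^bsub>GL2_pos\<^esub> (map rep Cs ! i)) \<inter> (\<Gamma> #>\<^bsub>GL2_pos\<^esub> (map rep Cs ! j)) = {}"
        using nth[of i] nth[of j] disj[of "Cs ! i" "Cs ! j"] Cs
        by (auto simp: nth_eq_iff_index_eq)
    qed
  qed
  then show ?thesis by blast
qed

theorem coset_sum_eq:
  assumes \<Gamma>: "subgroup \<Gamma> GL2_pos" and \<alpha>: "\<alpha> \<in> carrier GL2_pos"
    and as: "coset_decomposition \<Gamma> \<alpha> as"
    and inv: "\<And>\<gamma> \<beta>. \<gamma> \<in> \<Gamma> \<Longrightarrow> \<beta> \<in> carrier GL2_pos \<Longrightarrow> f (\<gamma> ** \<beta>) = f \<beta>"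
  shows "coset_sum \<Gamma> \<alpha> f = (\<Sum>i<length as. f (as ! i))"
proof -
  interpret GL: group GL2_pos by (rule group_GL2_pos)
  interpret S: subgroup \<Gamma> GL2_pos by fact
  define g where "g C = f (SOME x. x \<in> C)" for C
  define R where "R = (\<lambda>x. \<Gamma> #>\<^bsub>GL2_pos\<^esub> x) ` double_coset \<Gamma> \<alpha>"
  have dc: "double_coset \<Gamma> \<alpha> \<subseteq> carrier GL2_pos"
  proof
    fix x assume "x \<in> double_coset \<Gamma> \<alpha>"
    then obtain \<gamma> \<gamma>' where "\<gamma> \<in> \<Gamma>" "\<gamma>' \<in> \<Gamma>" "x = \<gamma> ** \<alpha> ** \<gamma>'"
      by (auto simp: double_coset_alt)
    then show "x \<in> carrier GL2_pos"
      using GL.m_closed[OF GL.m_closed[OF S.mem_carrier \<alpha>] S.mem_carrier] by simp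
  qed
  have *: "(\<Sum>i<length bs. f (bs ! i)) = (\<Sum>C\<in>R. g C)" if bs: "coset_decomposition \<Gamma> \<alpha> bs" for bs
  proof -
    have self: "x \<in> \<Gamma> #>\<^bsub>GL2_pos\<^esub> x" for x
      using S.one_closed by (auto simp: r_coset_def intro!: bexI[of _ "mat 1"])
    have mem: "bs ! i \<in> double_coset \<Gamma> \<alpha>" if "i < length bs" for i
      using bs self[of "bs ! i"] that unfolding coset_decomposition_def by blast
    have inj: "inj_on (\<lambda>i. \<Gamma> #>\<^bsub>GL2_pos\<^esub> (bs ! i)) {..<length bs}"
    proof (rule inj_onI, rule ccontr)
      fix i j assume ij: "i \<in> {..<length bs}" "j \<in> {..<length bs}" "i \<noteq> j"
        "\<Gamma> #>\<^bsub>GL2_pos\<^esub> (bs ! i) = \<Gamma> #>\<^bsub>GL2_pos\<^esub> (bs ! j)"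
      then have "(\<Gamma> #>\<^bsub>GL2_pos\<^esub> (bs ! i)) \<inter> (\<Gamma> #>\<^bsub>GL2_pos\<^esub> (bs ! j)) = {}"
        using bs unfolding coset_decomposition_def disjoint_family_on_def by blast
      with ij(4) self[of "bs ! i"] show False by auto
    qed
    have img: "(\<lambda>i. \<Gamma> #>\<^bsub>GL2_pos\<^esub> (bs ! i)) ` {..<length bs} = R"
    proof
      show "(\<lambda>i. \<Gamma> #>\<^bsub>GL2_pos\<^esub> (bs ! i)) ` {..<length bs} \<subseteq> R"
        using mem by (auto simp: R_def)
      show "R \<subseteq> (\<lambda>i. \<Gamma> #>\<^bsub>GL2_pos\<^esub> (bs ! i)) ` {..<length bs}"
      proof
        fix C assume "C \<in> R"
        then obtain x where x: "x \<in> double_coset \<Gamma> \<alpha>" "C = \<Gamma> #>\<^bsub>GL2_pos\<^esub> x" by (auto simp: R_def)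
        then obtain i where i: "i < length bs" "x \<in> \<Gamma> #>\<^bsub>GL2_pos\<^esub> (bs ! i)"
          using bs unfolding coset_decomposition_def by blast
        have "\<Gamma> #>\<^bsub>GL2_pos\<^esub> (bs ! i) = \<Gamma> #>\<^bsub>GL2_pos\<^esub> x"
          using GL.repr_independence[OF i(2) _ \<Gamma>] mem[OF i(1)] dc by blast
        with x i show "C \<in> (\<lambda>i. \<Gamma> #>\<^bsub>GL2_pos\<^esub> (bs ! i)) ` {..<length bs}" by auto
      qed
    qed
    have "(\<Sum>C\<in>R. g C) = (\<Sum>i<length bs. g (\<Gamma> #>\<^bsub>GL2_pos\<^esub> (bs ! i)))"
      unfolding img[symmetric] by (simp add: sum.reindex[OF inj])
    also have "\<dots> = (\<Sum>i<length bs. f (bs ! i))"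
    proof (rule sum.cong)
      fix i assume "i \<in> {..<length bs}"
      then have i: "bs ! i \<in> carrier GL2_pos" using mem dc by blast
      have "(SOME x. x \<in> \<Gamma> #>\<^bsub>GL2_pos\<^esub> (bs ! i)) \<in> \<Gamma> #>\<^bsub>GL2_pos\<^esub> (bs ! i)"
        using self by (rule someI)
      then obtain \<gamma> where "\<gamma> \<in> \<Gamma>" "(SOME x. x \<in> \<Gamma> #>\<^bsub>GL2_pos\<^esub> (bs ! i)) = \<gamma> ** bs ! i"
        by (auto simp: r_coset_def)
      then show "g (\<Gamma> #>\<^bsub>GL2_pos\<^esub> (bs ! i)) = f (bs ! i)"
        using inv i by (simp add: g_def)
    qed simp
    finally show ?thesis by simp
  qed
  have "coset_decomposition \<Gamma> \<alpha> (SOME as. coset_decomposition \<Gamma> \<alpha> as)"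
    using as by (rule someI)
  from *[OF this] *[OF as] show ?thesis by (simp add: coset_sum_def Let_def)
qed

lemma autJ_nonzero:
  assumes "det \<alpha> > 0" "z \<in> uhp"
  shows "autJ \<alpha> z \<noteq> 0"
proof
  assume "autJ \<alpha> z = 0"
  then have "\<alpha>$2$1 * Im z = 0" "\<alpha>$2$1 * Re z + \<alpha>$2$2 = 0"
    by (auto simp: autJ_def complex_eq_iff)
  with assms have "\<alpha>$2$1 = 0" "\<alpha>$2$2 = 0" by (auto simp: uhp_def)
  with assms(1) show False by (simp add: det_2)
qed

lemma moebius_in_uhp:
  assumes "det \<alpha> > 0" "z \<in> uhp"
  shows "moebius_act \<alpha> z \<in> uhp"
proof -
  have "Im (moebius_act \<alpha> z) = det \<alpha> * Im z / (norm (autJ \<alpha> z))\<^sup>2"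
    unfolding moebius_act_def Im_divide
    by (simp add: autJ_def det_2 cmod_power2 field_simps)
  with assms autJ_nonzero[OF assms] show ?thesis by (simp add: uhp_def)
qed

lemma autJ_mult:
  assumes "det \<alpha> > 0" "det \<beta> > 0" "z \<in> uhp"
  shows "autJ (\<alpha> ** \<beta>) z = autJ \<alpha> (moebius_act \<beta> z) * autJ \<beta> z"
  using autJ_nonzero[OF assms(2,3)]
  by (simp add: autJ_def moebius_act_def matrix_matrix_mult_def sum_2 field_simps)

lemma moebius_mult:
  assumes "det \<alpha> > 0" "det \<beta> > 0" "z \<in> uhp"
  shows "moebius_act (\<alpha> ** \<beta>) z = moebius_act \<alpha> (moebius_act \<beta> z)"
proof -
  note nz = autJ_nonzero[OF assms(2,3)]
  have "of_real (\<alpha>$1$1) * moebius_act \<beta> z + of_real (\<alpha>$1$2) =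
        (of_real ((\<alpha> ** \<beta>)$1$1) * z + of_real ((\<alpha> ** \<beta>)$1$2)) / autJ \<beta> z"
    using nz by (simp add: moebius_act_def matrix_matrix_mult_def sum_2 field_simps) (simp add: autJ_def field_simps)
  then have "moebius_act \<alpha> (moebius_act \<beta> z) =
      (of_real ((\<alpha> ** \<beta>)$1$1) * z + of_real ((\<alpha> ** \<beta>)$1$2)) / autJ \<beta> z / autJ \<alpha> (moebius_act \<beta> z)"
    by (simp add: moebius_act_def)
  then show ?thesis
    by (simp add: moebius_act_def[of "\<alpha> ** \<beta>"] autJ_mult[OF assms] mult.commute)
qed

lemma autK_mult:
  assumes "det \<alpha> > 0" "det \<beta> > 0" "z \<in> uhp"
  shows "autK (\<alpha> ** \<beta>) z =
         autK \<beta> z + of_real (det \<beta>) * autJ \<beta> z powi (-2) * autK \<alpha> (moebius_act \<beta> z)"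
proof -
  have nz: "autJ \<beta> z \<noteq> 0" "autJ \<alpha> (moebius_act \<beta> z) \<noteq> 0"
    using assms by (simp_all add: autJ_nonzero moebius_in_uhp)
  define a where "a = autJ \<alpha> (moebius_act \<beta> z)"
  define b where "b = autJ \<beta> z"
  have a: "a * b = of_real (\<alpha>$2$1) * (of_real (\<beta>$1$1) * z + of_real (\<beta>$1$2)) + of_real (\<alpha>$2$2) * b"
    using nz(1) unfolding a_def b_def autJ_def[of \<alpha>] moebius_act_def by (simp add: field_simps)
  have b: "b = of_real (\<beta>$2$1) * z + of_real (\<beta>$2$2)" by (simp add: b_def autJ_def)
  have "b * of_real (\<alpha>$2$1 * \<beta>$1$1 + \<alpha>$2$2 * \<beta>$2$1) =
        of_real (\<beta>$2$1) * (a * b) + of_real (det \<beta>) * of_real (\<alpha>$2$1)"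
    unfolding a unfolding b det_2 by (simp add: algebra_simps)
  then have "of_real (\<alpha>$2$1 * \<beta>$1$1 + \<alpha>$2$2 * \<beta>$2$1) / (a * b) =
        of_real (\<beta>$2$1) / b + of_real (det \<beta>) * b powi (-2) * (of_real (\<alpha>$2$1) / a)"
    using nz unfolding a_def[symmetric] b_def[symmetric]
    by (simp add: power_int_minus field_simps power2_eq_square)
  then show ?thesis
    unfolding autK_def autJ_mult[OF assms] a_def b_def
    by (simp add: matrix_matrix_mult_def sum_2)
qed

lemma slash_factor_mult:
  assumes "det \<alpha> > 0" "det \<beta> > 0" "z \<in> uhp"
  shows "slash_factor w (\<alpha> ** \<beta>) z = slash_factor w \<alpha> (moebius_act \<beta> z) * slash_factor w \<beta> z"
  using assms by (simp add: slash_factor_def autJ_mult det_mul powr_mult power_int_mult_distrib)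

lemma holomorphic_autJ: "autJ \<alpha> holomorphic_on uhp"
  unfolding autJ_def by (intro holomorphic_intros)

lemma holomorphic_autK: "det \<alpha> > 0 \<Longrightarrow> autK \<alpha> holomorphic_on uhp"
  unfolding autK_def using autJ_nonzero by (intro holomorphic_intros holomorphic_autJ) auto

lemma holomorphic_slash_factor: "det \<alpha> > 0 \<Longrightarrow> slash_factor w \<alpha> holomorphic_on uhp"
  unfolding slash_factor_def using autJ_nonzero by (intro holomorphic_intros holomorphic_autJ) auto

lemma holomorphic_eval_moebius:
  assumes "det \<alpha> > 0"
  shows "(\<lambda>z. eval_holo f (moebius_act \<alpha> z)) holomorphic_on uhp"
proof -
  have "moebius_act \<alpha> holomorphic_on uhp"
    unfolding moebius_act_def using assms autJ_nonzero by (intro holomorphic_intros holomorphic_autJ) auto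
  from holomorphic_on_compose_gen[OF this holomorphic_eval_holo[of f]] moebius_in_uhp[OF assms]
  show ?thesis by (auto simp: o_def)
qed

theorem fps_at_slashJ:
  assumes "det \<alpha> > 0" "z \<in> uhp"
  shows "fps_at (slashJ lam \<alpha> \<Phi>) z = slashJ_at lam \<alpha> \<Phi> z"
proof (rule fps_ext)
  fix n
  have "(\<lambda>z. fps_nth (slashJ_at lam \<alpha> \<Phi> z) n) holomorphic_on uhp"
    unfolding slashJ_at_def fps_compose_linear mult.assoc fps_mult_left_const_nth fps_mult_nth[of "fps_exp _"]
    using assms autJ_nonzero
    by (simp, intro holomorphic_intros holomorphic_slash_factor holomorphic_autK holomorphic_autJ
          holomorphic_eval_moebius) auto
  from eval_holo_of[OF this assms(2)]
  show "fps_nth (fps_at (slashJ lam \<alpha> \<Phi>) z) n = fps_nth (slashJ_at lam \<alpha> \<Phi> z) n"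
    by (simp add: slashJ_def)
qed

lemma poly_at_pCons: "poly_at (pCons f F) z = pCons (eval_holo f z) (poly_at F z)"
  by (rule poly_eqI) (simp add: coeff_pCons split: nat.splits)

theorem poly_at_slashP:
  assumes "det \<alpha> > 0" "z \<in> uhp"
  shows "poly_at (slashP w \<alpha> F) z = slashP_at w \<alpha> F z"
proof (rule poly_eqI)
  fix n
  define q where "q z = smult (inverse (of_real (det \<alpha>)) * autJ \<alpha> z ^ 2) [:- autK \<alpha> z, 1:]" for z
  have q: "q z * p = smult (inverse (of_real (det \<alpha>)) * autJ \<alpha> z ^ 2)
      (smult (- autK \<alpha> z) p + pCons 0 p)" for z p
    by (simp add: q_def smult_add_right smult_diff_right)
  have hol: "(\<lambda>z. coeff (pcompose (poly_at F (moebius_act \<alpha> z)) (q z)) n) holomorphic_on uhp" for n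
  proof (induction F arbitrary: n)
    case 0
    then show ?case by (simp add: poly_at_def)
  next
    case (pCons f F)
    note IH = pCons.IH
    have "(\<lambda>z. coeff (pCons 0 (pcompose (poly_at F (moebius_act \<alpha> z)) (q z))) n) holomorphic_on uhp"
      using IH by (cases n) auto
    moreover have "(\<lambda>z. coeff [:eval_holo f (moebius_act \<alpha> z):] n) holomorphic_on uhp"
      using holomorphic_eval_moebius[OF assms(1)] by (cases n) auto
    ultimately show ?case
      unfolding poly_at_pCons pcompose_pCons q coeff_add coeff_smult
      using assms IH by (intro holomorphic_intros holomorphic_autK holomorphic_autJ) auto
  qed
  have hol': "(\<lambda>z. coeff (slashP_at w \<alpha> F z) n) holomorphic_on uhp" for n
    unfolding slashP_at_def coeff_smult q_def[symmetric] using assms hol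
    by (intro holomorphic_intros holomorphic_slash_factor)
  have deg: "coeff (slashP_at w \<alpha> F z) k = 0" if "k > degree F" for z k
  proof (rule coeff_eq_0)
    have "degree (slashP_at w \<alpha> F z) \<le> degree (poly_at F (moebius_act \<alpha> z)) * degree (q z)"
      unfolding slashP_at_def q_def[symmetric]
      by (rule order.trans[OF degree_smult_le degree_pcompose_le])
    also have "\<dots> \<le> degree F * 1"
      by (intro mult_mono) (auto simp: q_def poly_at_def map_poly_degree_leq)
    finally show "degree (slashP_at w \<alpha> F z) < k" using that by simp
  qed
  have "coeff (slashP w \<alpha> F) = (\<lambda>n. holo_of (\<lambda>z. coeff (slashP_at w \<alpha> F z) n))"
    unfolding slashP_def
  proof (rule coeff_Abs_poly)
    fix k assume "k > degree F"
    then show "holo_of (\<lambda>z. coeff (slashP_at w \<alpha> F z) k) = 0"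
      using hol'[of k] deg by (intro holo_uhp_eqI) (simp add: eval_holo_of)
  qed
  then show "coeff (poly_at (slashP w \<alpha> F) z) n = coeff (slashP_at w \<alpha> F z) n"
    using eval_holo_of[OF hol' assms(2)] by simp
qed

theorem slashJ_slashJ:
  assumes "det \<alpha> > 0" "det \<beta> > 0"
  shows "slashJ lam \<beta> (slashJ lam \<alpha> \<Phi>) = slashJ lam (\<alpha> ** \<beta>) \<Phi>"
proof (rule holo_fps_eqI)
  fix z assume z: "z \<in> uhp"
  note mb = moebius_in_uhp[OF assms(2) z]
  have det: "det (\<alpha> ** \<beta>) > 0" using assms by (simp add: det_mul)
  define b where "b = complex_of_real (det \<beta>) * autJ \<beta> z powi (-2)"
  define a where "a = complex_of_real (det \<alpha>) * autJ \<alpha> (moebius_act \<beta> z) powi (-2)"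
  have ab: "complex_of_real (det (\<alpha> ** \<beta>)) * autJ (\<alpha> ** \<beta>) z powi (-2) = a * b"
    using assms z by (simp add: a_def b_def det_mul autJ_mult power_int_mult_distrib)
  have c0: "fps_nth (fps_const b * fps_X) 0 = 0" by simp
  have XX: "fps_compose (fps_compose f (fps_const a * fps_X)) (fps_const b * fps_X) =
      fps_compose f (fps_const (a * b) * fps_X)" for f :: "complex fps"
    unfolding fps_compose_linear by (simp add: fps_eq_iff power_mult_distrib)
  have "fps_compose (fps_at (slashJ lam \<alpha> \<Phi>) (moebius_act \<beta> z)) (fps_const b * fps_X) =
      fps_const (slash_factor lam \<alpha> (moebius_act \<beta> z)) * fps_exp (- (b * autK \<alpha> (moebius_act \<beta> z))) *
      fps_compose (fps_at \<Phi> (moebius_act (\<alpha> ** \<beta>) z)) (fps_const (a * b) * fps_X)"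
    unfolding fps_at_slashJ[OF assms(1) mb] slashJ_at_def a_def[symmetric] moebius_mult[OF assms z]
    by (simp only: fps_compose_mult_distrib[OF c0] fps_const_compose fps_exp_compose_linear XX mult_minus_right)
  then show "fps_at (slashJ lam \<beta> (slashJ lam \<alpha> \<Phi>)) z = fps_at (slashJ lam (\<alpha> ** \<beta>) \<Phi>) z"
    unfolding fps_at_slashJ[OF assms(2) z] fps_at_slashJ[OF det z] slashJ_at_def[of lam \<beta>]
      slashJ_at_def[of lam "\<alpha> ** \<beta>"] ab b_def[symmetric]
    unfolding slash_factor_mult[OF assms z] autK_mult[OF assms z] b_def[symmetric]
      minus_add_distrib fps_exp_add_mult fps_const_mult[symmetric]
    by (simp add: mult_ac)
qed

theorem slashP_slashP:
  assumes "det \<alpha> > 0" "det \<beta> > 0"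
  shows "slashP w \<beta> (slashP w \<alpha> F) = slashP w (\<alpha> ** \<beta>) F"
proof (rule holo_poly_eqI)
  fix z assume z: "z \<in> uhp"
  note mb = moebius_in_uhp[OF assms(2) z]
  have det: "det (\<alpha> ** \<beta>) > 0" using assms by (simp add: det_mul)
  have nz: "autJ \<beta> z \<noteq> 0" using autJ_nonzero[OF assms(2) z] .
  define b where "b = inverse (complex_of_real (det \<beta>)) * autJ \<beta> z ^ 2"
  define a where "a = inverse (complex_of_real (det \<alpha>)) * autJ \<alpha> (moebius_act \<beta> z) ^ 2"
  have b0: "b \<noteq> 0" using nz assms by (simp add: b_def)
  have ab: "inverse (complex_of_real (det (\<alpha> ** \<beta>))) * autJ (\<alpha> ** \<beta>) z ^ 2 = a * b"
    using assms z by (simp add: a_def b_def det_mul autJ_mult power_mult_distrib)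
  have K: "autK (\<alpha> ** \<beta>) z = autK \<beta> z + inverse b * autK \<alpha> (moebius_act \<beta> z)"
    using nz by (simp add: autK_mult[OF assms z] b_def power_int_minus)
  have comp: "pcompose (smult a [:- autK \<alpha> (moebius_act \<beta> z), 1:]) (smult b [:- autK \<beta> z, 1:]) =
      smult (a * b) [:- autK (\<alpha> ** \<beta>) z, 1:]"
    using b0 by (simp add: K pcompose_smult pcompose_pCons algebra_simps)
  show "poly_at (slashP w \<beta> (slashP w \<alpha> F)) z = poly_at (slashP w (\<alpha> ** \<beta>) F) z"
    unfolding poly_at_slashP[OF assms(2) z] poly_at_slashP[OF det z] slashP_at_def[of w \<beta>]
      slashP_at_def[of w "\<alpha> ** \<beta>"] ab b_def[symmetric] poly_at_slashP[OF assms(1) mb]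
    unfolding slashP_at_def[of w \<alpha>] a_def[symmetric] comp[symmetric]
    by (simp only: pcompose_smult[of "slash_factor _ _ _"] pcompose_assoc moebius_mult[OF assms z]
          slash_factor_mult[OF assms z] smult_smult mult.commute)
qed

theorem heckeJ_eq:
  assumes "subgroup \<Gamma> SL2_real" "\<alpha> \<in> commensurator \<Gamma>"
    and "\<Phi> \<in> jacobi_like \<Gamma> lam \<delta>" "coset_decomposition \<Gamma> \<alpha> as"
  shows "heckeJ \<Gamma> lam \<alpha> \<Phi> = (\<Sum>i<length as. slashJ lam (as ! i) \<Phi>)"
  unfolding heckeJ_def
proof (rule coset_sum_eq)
  fix \<gamma> \<beta> assume *: "\<gamma> \<in> \<Gamma>" "\<beta> \<in> carrier GL2_pos"
  then have "slashJ lam (\<gamma> ** \<beta>) \<Phi> = slashJ lam \<beta> (slashJ lam \<gamma> \<Phi>)"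
    using subgroup_SL2_imp_GL2(2)[OF assms(1)] by (intro slashJ_slashJ[symmetric]) auto
  also have "slashJ lam \<gamma> \<Phi> = \<Phi>" using assms(3) * by (simp add: jacobi_like_def)
  finally show "slashJ lam (\<gamma> ** \<beta>) \<Phi> = slashJ lam \<beta> \<Phi>" .
qed (use assms subgroup_SL2_imp_GL2(1) in \<open>auto simp: commensurator_def\<close>)

theorem heckeP_eq:
  assumes "subgroup \<Gamma> SL2_real" "\<alpha> \<in> commensurator \<Gamma>"
    and "F \<in> quasimodular_poly \<Gamma> w m" "coset_decomposition \<Gamma> \<alpha> as"
  shows "heckeP \<Gamma> w \<alpha> F = (\<Sum>i<length as. slashP w (as ! i) F)"
  unfolding heckeP_def
proof (rule coset_sum_eq)
  fix \<gamma> \<beta> assume *: "\<gamma> \<in> \<Gamma>" "\<beta> \<in> carrier GL2_pos"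
  then have "slashP w (\<gamma> ** \<beta>) F = slashP w \<beta> (slashP w \<gamma> F)"
    using subgroup_SL2_imp_GL2(2)[OF assms(1)] by (intro slashP_slashP[symmetric]) auto
  also have "slashP w \<gamma> F = F" using assms(3) * by (simp add: quasimodular_poly_def)
  finally show "slashP w (\<gamma> ** \<beta>) F = slashP w \<beta> F" .
qed (use assms subgroup_SL2_imp_GL2(1) in \<open>auto simp: commensurator_def\<close>)

end

theory Submission
  imports Defs
begin

text \<open>The map \<open>\<Pi>\<close> is additive and intertwines the two slash operators for every single matrix \<open>\<beta>\<close> of
  positive determinant, so the same list of coset representatives can be used on both sides. For the
  intertwining, write \<open>a = det(\<beta>) J(\<beta>,z)\<^sup>-\<^sup>2\<close>. The coefficient of \<open>X\<^sup>r\<close> is on either side a sum over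
  \<open>i \<le> m - r\<close> of multiples of \<open>(-K)\<^sup>i \<phi>\<^bsub>m-r-i\<^esub> / (i! r!)\<close>. Rescaling \<open>X\<close> in the power series contributes
  \<open>a\<^bsup>m-r-i+\<delta>\<^esup>\<close>, whereas in the polynomial it contributes \<open>a\<^bsup>-r-i\<^esup>\<close>; the difference \<open>a\<^bsup>m+\<delta>\<^esup>\<close> is exactly
  what the shift of the weight by \<open>2m + 2\<delta>\<close> provides.\<close>

text \<open>Since the shift is even, the exponent of the determinant grows by the integer
  \<open>n\<close>, so the real power splits off an ordinary one. The base of that power is the
  factor by which \<open>slashJ_at\<close> rescales X.\<close>

lemma slash_factor_add_even:
  assumes "det \<beta> > 0" "z \<in> uhp"
  shows "slash_factor (w + 2 * int n) \<beta> z =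
         slash_factor w \<beta> z * (of_real (det \<beta>) * autJ \<beta> z powi (-2)) ^ n"
proof -
  have "det \<beta> powr (of_int (w + 2 * int n) / 2) = det \<beta> powr (of_int w / 2) * det \<beta> ^ n"
    using assms(1) by (simp add: add_divide_distrib powr_add powr_realpow)
  moreover have "autJ \<beta> z powi (- (w + 2 * int n)) = autJ \<beta> z powi (- w) * (autJ \<beta> z powi (-2)) ^ n"
  proof -
    have "autJ \<beta> z powi (- (w + 2 * int n)) = autJ \<beta> z powi (- w + (-2) * int n)" by simp
    also have "\<dots> = autJ \<beta> z powi (- w) * autJ \<beta> z powi ((-2) * int n)"
      using autJ_nonzero[OF assms] by (subst power_int_add) auto
    finally show ?thesis by (simp only: power_int_mult power_int_of_nat)
  qed
  ultimately show ?thesis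
    by (simp add: slash_factor_def power_mult_distrib mult_ac)
qed

lemma coeff_Pi_map:
  "coeff (Pi_map \<delta> m \<Phi>) r = (if r \<le> m then holo_of (\<lambda>_. 1 / fact r) * fps_nth \<Phi> (m - r + \<delta>) else 0)"
  by (simp add: Pi_map_def coeff_sum)

lemma coeff_poly_at_Pi_map:
  assumes "z \<in> uhp"
  shows "coeff (poly_at (Pi_map \<delta> m \<Phi>) z) r =
    (if r \<le> m then fps_nth (fps_at \<Phi> z) (m - r + \<delta>) / fact r else 0)"
  using assms by (simp add: coeff_Pi_map eval_holo_of)

lemma Pi_map_sum: "Pi_map \<delta> m (sum f A) = (\<Sum>x\<in>A. Pi_map \<delta> m (f x))"
  by (rule poly_eqI) (simp add: coeff_Pi_map coeff_sum fps_sum_nth sum_distrib_left)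

text \<open>Cauchy product of exp(-K X) with the rescaled series.\<close>

lemma fps_nth_slashJ_at:
  fixes \<beta> :: "real^2^2" and z :: complex
  assumes "\<Phi> \<in> fps_delta \<delta>"
  defines "a \<equiv> of_real (det \<beta>) * autJ \<beta> z powi (-2)"
  shows "fps_nth (slashJ_at w \<beta> \<Phi> z) (n + \<delta>) = slash_factor w \<beta> z *
    (\<Sum>i\<le>n. (- autK \<beta> z) ^ i / fact i *
      (a ^ (n - i + \<delta>) * fps_nth (fps_at \<Phi> (moebius_act \<beta> z)) (n - i + \<delta>)))"
proof -
  have zero: "fps_nth \<Phi> k = 0" if "k < \<delta>" for k
    using assms(1) that by (auto simp: fps_delta_def fps_X_power_mult_nth)
  \<comment> \<open>For \<open>i > n\<close> the index \<open>n + \<delta> - i\<close> falls below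
    \<open>\<delta>\<close>, where the coefficients of \<open>\<Phi>\<close> vanish.\<close>
  have "(\<Sum>i=0..n+\<delta>. (- autK \<beta> z) ^ i / fact i *
      (a ^ (n + \<delta> - i) * fps_nth (fps_at \<Phi> (moebius_act \<beta> z)) (n + \<delta> - i))) =
    (\<Sum>i\<le>n. (- autK \<beta> z) ^ i / fact i *
      (a ^ (n + \<delta> - i) * fps_nth (fps_at \<Phi> (moebius_act \<beta> z)) (n + \<delta> - i)))"
    by (rule sum.mono_neutral_right) (auto simp: zero)
  also have "\<dots> = (\<Sum>i\<le>n. (- autK \<beta> z) ^ i / fact i *
      (a ^ (n - i + \<delta>) * fps_nth (fps_at \<Phi> (moebius_act \<beta> z)) (n - i + \<delta>)))"
    by (intro sum.cong) auto
  finally show ?thesis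
    unfolding slashJ_at_def a_def[symmetric] fps_compose_linear mult.assoc fps_mult_left_const_nth
      fps_mult_nth[of "fps_exp _"]
    by simp
qed

text \<open>Binomial theorem applied to each monomial of \<open>p\<close>. For \<open>k < r\<close>
  the truncated exponent \<open>k - r\<close> is harmless because the binomial coefficient is
  0.\<close>

lemma coeff_pcompose_linear:
  fixes p :: "'a::comm_ring_1 poly"
  assumes "degree p \<le> m"
  shows "coeff (pcompose p (smult b [:c, 1:])) r =
    (\<Sum>k\<le>m. coeff p k * b ^ k * of_nat (k choose r) * c ^ (k - r))"
proof -
  have monom: "pcompose (monom d k) q = smult d (q ^ k)" for d :: 'a and k q
    by (induction k) (simp_all add: monom_0 monom_Suc pcompose_pCons mult_ac)
  have "pcompose p q = (\<Sum>k\<le>m. smult (coeff p k) (q ^ k))" for q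
  proof -
    have "pcompose p q = pcompose (\<Sum>k\<le>m. monom (coeff p k) k) q"
      using poly_as_sum_of_monoms'[OF assms] by simp
    also have "\<dots> = (\<Sum>k\<le>m. smult (coeff p k) (q ^ k))"
      by (simp add: pcompose_sum monom)
    finally show ?thesis .
  qed
  moreover have "coeff ([:c, 1:] ^ k) r = of_nat (k choose r) * c ^ (k - r)" for k
  proof (cases "r \<le> k")
    case False
    then have "degree ([:c, 1:] ^ k) < r"
      using degree_power_le[of "[:c, 1:]" k] by (simp add: not_le)
    with False show ?thesis by (simp add: coeff_eq_0 binomial_eq_0)
  qed (simp add: coeff_linear_poly_power)
  ultimately show ?thesis
    by (simp only: coeff_sum coeff_smult smult_power mult.assoc)
qed

text \<open>Both coefficient sums have the range \<open>i \<le> m - r\<close>: on the left because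
  \<open>\<Phi>\<close> starts at \<open>\<delta>\<close>, on the right because the polynomial has
  degree at most \<open>m\<close>.\<close>

lemma Pi_map_slashJ:
  assumes "det \<beta> > 0" "\<Phi> \<in> fps_delta \<delta>"
  shows "Pi_map \<delta> m (slashJ w \<beta> \<Phi>) = slashP (w + 2 * int m + 2 * int \<delta>) \<beta> (Pi_map \<delta> m \<Phi>)"
proof (rule holo_poly_eqI, rule poly_eqI)
  fix z r assume z: "z \<in> uhp"
  define u where "u = moebius_act \<beta> z"
  define K where "K = autK \<beta> z"
  define a where "a = complex_of_real (det \<beta>) * autJ \<beta> z powi (-2)"
  define \<phi> where "\<phi> k = fps_nth (fps_at \<Phi> u) (k + \<delta>)" for k
  have u: "u \<in> uhp" using moebius_in_uhp[OF assms(1) z] by (simp add: u_def)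
  have a0: "a \<noteq> 0" using autJ_nonzero[OF assms(1) z] assms(1) by (simp add: a_def)
  \<comment> \<open>The two slash operators rescale X by mutually inverse factors, so
    \<open>a\<close> governs both sides.\<close>
  have inv: "inverse (complex_of_real (det \<beta>)) * autJ \<beta> z ^ 2 = inverse a"
    by (simp add: a_def power_int_minus)
  have sf: "slash_factor (w + 2 * int m + 2 * int \<delta>) \<beta> z = slash_factor w \<beta> z * a ^ (m + \<delta>)"
    using slash_factor_add_even[OF assms(1) z, of w "m + \<delta>"] by (simp add: a_def add_ac)
  have deg: "degree (poly_at (Pi_map \<delta> m \<Phi>) u) \<le> m"
    by (rule degree_le) (simp add: coeff_Pi_map)
  have R: "coeff (poly_at (slashP (w + 2 * int m + 2 * int \<delta>) \<beta> (Pi_map \<delta> m \<Phi>)) z) r =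
      slash_factor w \<beta> z * a ^ (m + \<delta>) *
      (\<Sum>k\<le>m. \<phi> (m - k) / fact k * inverse a ^ k * of_nat (k choose r) * (- K) ^ (k - r))"
    unfolding poly_at_slashP[OF assms(1) z] slashP_at_def coeff_smult inv sf u_def[symmetric] K_def[symmetric]
      coeff_pcompose_linear[OF deg] coeff_poly_at_Pi_map[OF u] \<phi>_def
    by simp
  show "coeff (poly_at (Pi_map \<delta> m (slashJ w \<beta> \<Phi>)) z) r =
    coeff (poly_at (slashP (w + 2 * int m + 2 * int \<delta>) \<beta> (Pi_map \<delta> m \<Phi>)) z) r"
  proof (cases "r \<le> m")
    case False
    then have "(\<Sum>k\<le>m. \<phi> (m - k) / fact k * inverse a ^ k * of_nat (k choose r) * (- K) ^ (k - r)) = 0"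
      by (intro sum.neutral) (auto simp: binomial_eq_0)
    with False show ?thesis unfolding R coeff_poly_at_Pi_map[OF z] by simp
  next
    case True
    \<comment> \<open>Terms with \<open>k < r\<close> vanish; putting \<open>k = i + r\<close> makes
      \<open>i\<close> the exponent of \<open>- K\<close>, as in the Cauchy product.\<close>
    have "(\<Sum>k\<le>m. \<phi> (m - k) / fact k * inverse a ^ k * of_nat (k choose r) * (- K) ^ (k - r)) =
        (\<Sum>k=r..m. \<phi> (m - k) / fact k * inverse a ^ k * of_nat (k choose r) * (- K) ^ (k - r))"
      by (rule sum.mono_neutral_right) (auto simp: binomial_eq_0)
    also have "\<dots> = (\<Sum>i\<le>m-r. \<phi> (m - (i + r)) / fact (i + r) * inverse a ^ (i + r) *
        of_nat (i + r choose r) * (- K) ^ i)"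
      using True by (intro sum.reindex_bij_witness[of _ "\<lambda>i. i + r" "\<lambda>k. k - r"]) auto
    finally have S: "a ^ (m + \<delta>) * (\<Sum>k\<le>m. \<phi> (m - k) / fact k * inverse a ^ k * of_nat (k choose r) * (- K) ^ (k - r)) =
       (\<Sum>i\<le>m-r. a ^ (m + \<delta>) * (\<phi> (m - (i + r)) / fact (i + r) * inverse a ^ (i + r) *
        of_nat (i + r choose r) * (- K) ^ i))"
      by (simp add: sum_distrib_left)
    have T: "a ^ (m + \<delta>) * (\<phi> (m - (i + r)) / fact (i + r) * inverse a ^ (i + r) *
        of_nat (i + r choose r) * (- K) ^ i) =
       (- K) ^ i / fact i * (a ^ (m - r - i + \<delta>) * \<phi> (m - r - i)) / fact r" if "i \<le> m - r" for i
    proof -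
      have "a ^ (m + \<delta>) = a ^ (m - r - i + \<delta>) * a ^ (i + r)"
        using that True by (simp flip: power_add)
      then have pow: "a ^ (m + \<delta>) * inverse a ^ (i + r) = a ^ (m - r - i + \<delta>)"
        using a0 by (simp add: power_inverse mult.assoc)
      \<comment> \<open>The factorial from \<open>Pi_map\<close> and the binomial coefficient from
        the expansion combine into the exponential coefficient 1/i! and the factor 1/r! of
        \<open>Pi_map\<close> on the other side.\<close>
      have binom: "of_nat (i + r choose r) * inverse (fact (i + r)) = (inverse (fact i) * inverse (fact r) :: complex)"
        using binomial_fact[of r "i + r", where 'a = complex] by (simp add: divide_inverse)
      have "a ^ (m + \<delta>) * (\<phi> (m - (i + r)) / fact (i + r) * inverse a ^ (i + r) *
          of_nat (i + r choose r) * (- K) ^ i) =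
        (a ^ (m + \<delta>) * inverse a ^ (i + r)) * (of_nat (i + r choose r) * inverse (fact (i + r))) *
          (\<phi> (m - (i + r)) * (- K) ^ i)"
        by (simp only: divide_inverse mult_ac)
      moreover have "m - (i + r) = m - r - i" by simp
      ultimately show ?thesis
        unfolding pow binom by (simp only: divide_inverse mult_ac)
    qed
    have "(\<Sum>i\<le>m-r. a ^ (m + \<delta>) * (\<phi> (m - (i + r)) / fact (i + r) * inverse a ^ (i + r) *
        of_nat (i + r choose r) * (- K) ^ i)) =
       (\<Sum>i\<le>m-r. (- K) ^ i / fact i * (a ^ (m - r - i + \<delta>) * \<phi> (m - r - i))) / fact r"
      unfolding sum_divide_distrib by (intro sum.cong refl T) simp
    then show ?thesis
      unfolding R mult.assoc[of "slash_factor w \<beta> z"] S coeff_poly_at_Pi_map[OF z]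
        fps_at_slashJ[OF assms(1) z] fps_nth_slashJ_at[OF assms(2)] u_def[symmetric] K_def[symmetric]
        a_def[symmetric] \<phi>_def[symmetric]
      using True by (simp only: if_True times_divide_eq_right)
  qed
qed

text \<open>As \<open>\<Gamma>\<close> contains the identity, each representative lies in its own
  coset and hence in the double coset. This makes \<open>Pi_map_slashJ\<close> applicable to
  it.\<close>

lemma coset_decomposition_det_pos:
  assumes "subgroup \<Gamma> GL2_pos" "\<alpha> \<in> carrier GL2_pos" "coset_decomposition \<Gamma> \<alpha> as" "i < length as"
  shows "det (as ! i) > 0"
proof -
  interpret S: subgroup \<Gamma> GL2_pos by fact
  have "as ! i \<in> \<Gamma> #>\<^bsub>GL2_pos\<^esub> (as ! i)"
    using S.one_closed by (auto simp: r_coset_def intro!: bexI[of _ "mat 1"])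
  then have "as ! i \<in> double_coset \<Gamma> \<alpha>"
    using assms(3,4) unfolding coset_decomposition_def by blast
  then obtain \<gamma> \<gamma>' where "\<gamma> \<in> \<Gamma>" "\<gamma>' \<in> \<Gamma>" "as ! i = \<gamma> ** \<alpha> ** \<gamma>'"
    unfolding double_coset_alt by blast
  then show ?thesis
    using assms(2) S.mem_carrier[of \<gamma>] S.mem_carrier[of \<gamma>'] by (simp add: det_mul)
qed

theorem theorem4p5:
  fixes \<Gamma> :: "(real^2^2) set" and \<alpha> :: "real^2^2"
    and m \<delta> :: nat and lam :: int and \<Phi> :: "holo_uhp fps"
  assumes "subgroup \<Gamma> SL2_real" and "discrete \<Gamma>"
    and "\<alpha> \<in> commensurator \<Gamma>"
    and "\<Phi> \<in> jacobi_like \<Gamma> lam \<delta>"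
  shows "Pi_map \<delta> m (heckeJ \<Gamma> lam \<alpha> \<Phi>) =
         heckeP \<Gamma> (lam + 2 * int m + 2 * int \<delta>) \<alpha> (Pi_map \<delta> m \<Phi>)"
proof -
  \<comment> \<open>This is the choice made inside \<open>coset_sum\<close>. It depends only on
    \<open>\<Gamma>\<close> and \<open>\<alpha>\<close>, so both Hecke operators sum over this same
    list.\<close>
  define as where "as = (SOME as. coset_decomposition \<Gamma> \<alpha> as)"
  have \<Gamma>: "subgroup \<Gamma> GL2_pos" using assms(1) by (rule subgroup_SL2_imp_GL2)
  have "coset_decomposition \<Gamma> \<alpha> as"
    unfolding as_def using coset_decomposition_exists[OF \<Gamma> assms(3)] by (rule someI_ex)
  then have "det (as ! i) > 0" if "i < length as" for i
    using coset_decomposition_det_pos[OF \<Gamma> _ _ that] assms(3) by (auto simp: commensurator_def)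
  moreover have "\<Phi> \<in> fps_delta \<delta>" using assms(4) by (simp add: jacobi_like_def)
  ultimately show ?thesis
    unfolding heckeJ_def heckeP_def coset_sum_def Let_def as_def[symmetric] Pi_map_sum
    by (intro sum.cong refl Pi_map_slashJ) simp_all
qed

end
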